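(* Let $Y$ be a real random variable with $\mathbb{E}e^{s|Y|}<\infty$ for some $s>0$, and let $A(x)=(A_n(x))_{n\geq 0}$ be a sequence of polynomials whose exponential generating function satisfies $$\sum_{n=0}^\infty A_n(x)\frac{z^n}{n!}=\frac{e^{xz}}{\mathbb{E}e^{zY}}$$ for all complex $z$ with $|z|$ sufficiently small (i.e. $A(x)\in\mathcal{R}$ with associated random variable $Y$). Then for every $n\in\mathbb{N}_0$ and $x\in\mathbb{R}$, $$A_n(x)=\sum_{r=0}^n(-1)^r r!\,S_Y(n,r;x)=\sum_{k=0}^n\binom{n+1}{k+1}(-1)^k\,\mathbb{E}(x+S_k)^n=\sum_{r=0}^n\binom{n}{r}x^{n-r}\sum_{k=0}^r\binom{r+1}{k+1}(-1)^k\,\mathbb{E}S_k^r.$$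
   Context: Let $(Y_j)_{j\geq1}$ be a sequence of independent copies of $Y$ and $S_k=Y_1+\cdots+Y_k$ for $k\in\mathbb{N}$, $S_0=0$. The Stirling polynomials of the second kind associated to $Y$ are $$S_Y(n,r;x)=\frac{1}{r!}\sum_{k=0}^r\binom{r}{k}(-1)^{r-k}\mathbb{E}(x+S_k)^n,\quad r=0,1,\ldots,n,$$ equivalently defined by $\frac{e^{zx}}{r!}(\mathbb{E}e^{zY}-1)^r=\sum_{n\geq r}S_Y(n,r;x)\frac{z^n}{n!}$. Convention $0^0=1$. *)

theory Defs
  imports "HOL-Probability.Probability"
begin

(* The copies X 1, X 2, ... may live on a probability space N other than the space M carrying Y.
   Measurability of each X j is part of indep_vars; X 0 is irrelevant. *)
definition indep_copies ::
    "'a measure \<Rightarrow> ('a \<Rightarrow> real) \<Rightarrow> 'b measure \<Rightarrow> (nat \<Rightarrow> 'b \<Rightarrow> real) \<Rightarrow> bool" where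
  "indep_copies M Y N X \<longleftrightarrow>
     prob_space.indep_vars N (\<lambda>_. borel) X {1..} \<and>
     (\<forall>j\<ge>1. distr N borel (X j) = distr M borel Y)"

definition psum :: "(nat \<Rightarrow> 'b \<Rightarrow> real) \<Rightarrow> nat \<Rightarrow> 'b \<Rightarrow> real" where
  "psum X k \<omega> = (\<Sum>j=1..k. X j \<omega>)"

(* The Stirling polynomial of the second kind associated to Y, for a sequence X of
   independent copies of Y on N; it depends on X only through the distribution of Y. *)
definition stirling2_poly ::
    "'b measure \<Rightarrow> (nat \<Rightarrow> 'b \<Rightarrow> real) \<Rightarrow> nat \<Rightarrow> nat \<Rightarrow> real \<Rightarrow> real" where
  "stirling2_poly N X n r x =
     1 / fact r * (\<Sum>k=0..r. real (r choose k) * (-1) ^ (r - k) *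
        prob_space.expectation N (\<lambda>\<omega>. (x + psum X k \<omega>) ^ n))"

end

theory Submission
  imports Defs "HOL-Complex_Analysis.Complex_Analysis"
begin

(* Everything is a computation with the formal power series G of the moment generating function
   of Y. By independence x + S_k has the moment series exp(xz) G^k, and by uniqueness of power
   series expansions the series of A(x) is exp(xz) / G. Since 1 - G has zero constant term,
   exp(xz) / G and exp(xz) (1 + (1 - G) + ... + (1 - G)^n) agree up to degree n. Reading off
   the coefficient of z^n gives the first formula; expanding the powers of 1 - G gives the
   second one; the factorisation of exp(xz) / G into exp(xz) and the series of A(0) gives
   the third one. *)

section \<open>Moments of independent sums as products of formal power series\<close>

text \<open>The series is purely formal, so products and powers of it carry no convergence
  conditions. A power that is not integrable contributes the default value 0, which is why
  integrability of powers is tracked separately below.\<close>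

definition moment_egf :: "'a measure \<Rightarrow> ('a \<Rightarrow> real) \<Rightarrow> real fps" where
  "moment_egf M U = Abs_fps (\<lambda>n. integral\<^sup>L M (\<lambda>\<omega>. U \<omega> ^ n) / fact n)"

lemma moment_egf_nth: "fps_nth (moment_egf M U) n = integral\<^sup>L M (\<lambda>\<omega>. U \<omega> ^ n) / fact n"
  by (simp add: moment_egf_def)

lemma (in prob_space) moment_egf_const: "moment_egf M (\<lambda>_. x) = fps_exp x"
  by (rule fps_ext) (simp add: moment_egf_nth prob_space)

lemma moment_egf_distr:
  assumes "U \<in> borel_measurable M"
  shows "moment_egf (distr M borel U) (\<lambda>y. y) = moment_egf M U"
  using assms by (intro fps_ext) (simp add: moment_egf_nth integral_distr)

text \<open>The factorials are distributed as in the Cauchy product behind exp((a+b)z) = exp(az)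
  exp(bz), the shape required for multiplying moment series.\<close>

lemma binomial_add_div_fact:
  fixes a b :: real
  shows "(a + b) ^ n / fact n = (\<Sum>i=0..n. (a ^ i / fact i) * (b ^ (n - i) / fact (n - i)))"
proof -
  have "fps_nth (fps_exp (a + b)) n = fps_nth (fps_exp a * fps_exp b) n"
    by (simp only: fps_exp_add_mult)
  then show ?thesis
    by (simp add: fps_mult_nth)
qed

context prob_space
begin

context
  fixes U V :: "'a \<Rightarrow> real"
  assumes indep: "indep_var borel U borel V"
    and int_U: "\<And>n. integrable M (\<lambda>\<omega>. U \<omega> ^ n)"
    and int_V: "\<And>n. integrable M (\<lambda>\<omega>. V \<omega> ^ n)"
begin

lemma indep_var_powers:
  "indep_var borel (\<lambda>\<omega>. U \<omega> ^ i) borel (\<lambda>\<omega>. V \<omega> ^ j)"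
  using indep_var_compose[OF indep, of "\<lambda>u. u ^ i" borel "\<lambda>v. v ^ j" borel]
  by (simp add: comp_def)

lemma integrable_power_products: "integrable M (\<lambda>\<omega>. U \<omega> ^ i * V \<omega> ^ j)"
  by (rule indep_var_integrable[OF indep_var_powers int_U int_V])

lemma expectation_power_products:
  "expectation (\<lambda>\<omega>. U \<omega> ^ i * V \<omega> ^ j) = expectation (\<lambda>\<omega>. U \<omega> ^ i) * expectation (\<lambda>\<omega>. V \<omega> ^ j)"
  by (rule indep_var_lebesgue_integral[OF indep_var_powers int_U int_V])

lemma integrable_power_add_indep: "integrable M (\<lambda>\<omega>. (U \<omega> + V \<omega>) ^ n)"
  unfolding binomial_ring
  by (intro Bochner_Integration.integrable_sum)
     (simp add: mult.assoc integrable_power_products)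

text \<open>The binomial theorem divided by n! is a Cauchy product, and by independence the
  expectation of each mixed term factors.\<close>

lemma moment_egf_add_indep:
  "moment_egf M (\<lambda>\<omega>. U \<omega> + V \<omega>) = moment_egf M U * moment_egf M V"
proof (rule fps_ext)
  fix n
  have "fps_nth (moment_egf M (\<lambda>\<omega>. U \<omega> + V \<omega>)) n =
      expectation (\<lambda>\<omega>. \<Sum>i=0..n. (U \<omega> ^ i * V \<omega> ^ (n - i)) / (fact i * fact (n - i)))"
    unfolding moment_egf_nth
    by (simp add: binomial_add_div_fact flip: integral_divide_zero)
  also have "\<dots> = fps_nth (moment_egf M U * moment_egf M V) n"
    by (simp add: integrable_power_products expectation_power_products moment_egf_nth fps_mult_nth)
  finally show "fps_nth (moment_egf M (\<lambda>\<omega>. U \<omega> + V \<omega>)) n =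
      fps_nth (moment_egf M U * moment_egf M V) n" .
qed

end

end

section \<open>From the analytic generating function to a formal identity\<close>

lemma integrable_power_of_exp_moment:
  fixes Y :: "'a \<Rightarrow> real"
  assumes "Y \<in> borel_measurable M" and "s > 0"
    and "integrable M (\<lambda>\<omega>. exp (s * \<bar>Y \<omega>\<bar>))"
  shows "integrable M (\<lambda>\<omega>. Y \<omega> ^ n)"
proof (rule Bochner_Integration.integrable_bound)
  show "integrable M (\<lambda>\<omega>. fact n / s ^ n * exp (s * \<bar>Y \<omega>\<bar>))"
    using assms by simp
  show "(\<lambda>\<omega>. Y \<omega> ^ n) \<in> borel_measurable M"
    using assms by measurable
  have "\<bar>y\<bar> ^ n \<le> fact n / s ^ n * exp (s * \<bar>y\<bar>)" for y :: real
  proof -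
    \<comment> \<open>A single term of the exponential series is bounded by its sum, as all terms
      are nonnegative.\<close>
    have "(\<Sum>k\<in>{n}. (s * \<bar>y\<bar>) ^ k /\<^sub>R fact k) \<le> exp (s * \<bar>y\<bar>)"
      unfolding exp_def using \<open>s > 0\<close>
      by (intro sum_le_suminf summable_exp_generic) auto
    then show ?thesis
      using \<open>s > 0\<close> by (simp add: field_simps power_mult_distrib)
  qed
  then show "AE \<omega> in M. norm (Y \<omega> ^ n) \<le> norm (fact n / s ^ n * exp (s * \<bar>Y \<omega>\<bar>))"
    using \<open>s > 0\<close> by (simp add: power_abs)
qed

text \<open>Dominated convergence lets the expectation pass through the exponential series: when |z|
  \<le> s, every partial sum is bounded in norm by the integrable function exp(s|Y|).\<close>

lemma mgf_sums:
  fixes Y :: "'a \<Rightarrow> real" and z :: complex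
  assumes Y: "Y \<in> borel_measurable M" and "s > 0"
    and int: "integrable M (\<lambda>\<omega>. exp (s * \<bar>Y \<omega>\<bar>))" and z: "norm z \<le> s"
  shows "(\<lambda>n. of_real (fps_nth (moment_egf M Y) n) * z ^ n) sums
      integral\<^sup>L M (\<lambda>\<omega>. exp (z * of_real (Y \<omega>)))"
proof -
  let ?f = "\<lambda>n \<omega>. (\<Sum>k<n. (z * of_real (Y \<omega>)) ^ k / fact k)"
  have int_pow: "integrable M (\<lambda>\<omega>. of_real (Y \<omega> ^ k) :: complex)" for k
    using integrable_power_of_exp_moment[OF Y \<open>s > 0\<close> int]
    by (rule integrable_of_real)
  have "(\<lambda>n. integral\<^sup>L M (?f n)) \<longlonglongrightarrow> integral\<^sup>L M (\<lambda>\<omega>. exp (z * of_real (Y \<omega>)))"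
  proof (rule integral_dominated_convergence[where w = "\<lambda>\<omega>. exp (s * \<bar>Y \<omega>\<bar>)"])
    show "AE \<omega> in M. (\<lambda>n. ?f n \<omega>) \<longlonglongrightarrow> exp (z * of_real (Y \<omega>))"
      using exp_converges[of "z * of_real (Y _)"]
      by (simp add: sums_def scaleR_conv_of_real divide_inverse_commute)
    show "AE \<omega> in M. norm (?f n \<omega>) \<le> exp (s * \<bar>Y \<omega>\<bar>)" for n
    proof (rule AE_I2)
      fix \<omega>
      have "norm (?f n \<omega>) \<le> (\<Sum>k<n. (norm z * \<bar>Y \<omega>\<bar>) ^ k /\<^sub>R fact k)"
        by (rule sum_norm_le) (simp add: norm_mult norm_power norm_divide field_simps)
      also have "\<dots> \<le> exp (norm z * \<bar>Y \<omega>\<bar>)"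
        unfolding exp_def by (intro sum_le_suminf summable_exp_generic) auto
      also have "\<dots> \<le> exp (s * \<bar>Y \<omega>\<bar>)"
        using z by (simp add: mult_right_mono)
      finally show "norm (?f n \<omega>) \<le> exp (s * \<bar>Y \<omega>\<bar>)" .
    qed
  qed (use Y int in measurable)
  moreover have "integral\<^sup>L M (?f n) = (\<Sum>k<n. of_real (fps_nth (moment_egf M Y) k) * z ^ k)" for n
    using int_pow
    by (simp add: moment_egf_nth power_mult_distrib mult.commute flip: of_real_power)
  ultimately show ?thesis
    by (simp add: sums_def)
qed

lemma has_fps_expansion_sumsI:
  fixes f :: "complex \<Rightarrow> complex"
  assumes "\<forall>\<^sub>F z in nhds 0. (\<lambda>n. fps_nth F n * z ^ n) sums f z"
  shows "f has_fps_expansion F"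
proof -
  obtain r where r: "r > 0" "\<And>z. dist z 0 < r \<Longrightarrow> (\<lambda>n. fps_nth F n * z ^ n) sums f z"
    using assms by (auto simp: eventually_nhds_metric)
  \<comment> \<open>Convergence at one nonzero point already forces a positive radius of
    convergence; r/2 is such a point inside the disc.\<close>
  have "summable (\<lambda>n. fps_nth F n * complex_of_real (r / 2) ^ n)"
    using r(2)[of "of_real (r / 2)"] r(1) by (auto simp: sums_iff)
  then have "ereal (norm (complex_of_real (r / 2))) \<le> fps_conv_radius F"
    unfolding fps_conv_radius_def by (rule conv_radius_geI)
  moreover have "0 < ereal (norm (complex_of_real (r / 2)))"
    using r(1) by simp
  ultimately have "fps_conv_radius F > 0"
    by (rule less_le_trans[rotated])
  moreover have "\<forall>\<^sub>F z in nhds 0. eval_fps F z = f z"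
    using assms by eventually_elim (simp add: eval_fps_def sums_iff)
  ultimately show ?thesis
    by (simp add: has_fps_expansion_def)
qed

text \<open>The given series and the formal quotient of exp(tz) by the moment series both expand the
  same function near 0, so uniqueness of expansions identifies them. From here on only formal series
  occur.\<close>

lemma fps_mult_moment_egf_eq_fps_exp:
  fixes Y :: "'a \<Rightarrow> real" and a :: "nat \<Rightarrow> real" and t :: real
  assumes "prob_space M" and Y: "Y \<in> borel_measurable M" and "s > 0"
    and int: "integrable M (\<lambda>\<omega>. exp (s * \<bar>Y \<omega>\<bar>))"
    and egf: "\<forall>\<^sub>F z :: complex in nhds 0.
      (\<lambda>m. of_real (a m) * z ^ m / fact m) sums
        (exp (of_real t * z) / integral\<^sup>L M (\<lambda>\<omega>. exp (z * of_real (Y \<omega>))))"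
  shows "Abs_fps (\<lambda>m. a m / fact m) * moment_egf M Y = fps_exp t"
proof -
  interpret prob_space M by fact
  let ?D = "\<lambda>z :: complex. expectation (\<lambda>\<omega>. exp (z * of_real (Y \<omega>)))"
  define G where "G = Abs_fps (\<lambda>n. complex_of_real (fps_nth (moment_egf M Y) n))"
  define F where "F = Abs_fps (\<lambda>m. complex_of_real (a m / fact m))"
  have G0: "fps_nth G 0 \<noteq> 0"
    by (simp add: G_def moment_egf_nth prob_space)
  have "\<forall>\<^sub>F z in nhds (0 :: complex). norm z < s"
    using \<open>s > 0\<close> eventually_nhds_metric by fastforce
  then have "\<forall>\<^sub>F z in nhds 0. (\<lambda>n. fps_nth G n * z ^ n) sums ?D z"
    by eventually_elim (use mgf_sums[OF Y \<open>s > 0\<close> int] in \<open>simp add: G_def\<close>)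
  then have "?D has_fps_expansion G"
    by (rule has_fps_expansion_sumsI)
  then have "(\<lambda>z. exp (of_real t * z) / ?D z) has_fps_expansion fps_exp (of_real t) / G"
    using G0 by (intro has_fps_expansion_divide' has_fps_expansion_exp)
  moreover have "(\<lambda>z. exp (of_real t * z) / ?D z) has_fps_expansion F"
    by (rule has_fps_expansion_sumsI) (use egf in \<open>simp add: F_def\<close>)
  ultimately have "F = fps_exp (of_real t) / G"
    using fps_expansion_unique_complex by blast
  then have "F * G = fps_exp (of_real t)"
    using G0 by (simp add: fps_divide_unit inverse_mult_eq_1 mult.assoc)
  then have "fps_nth (F * G) n = fps_nth (fps_exp (of_real t)) n" for n
    by simp
  \<comment> \<open>All coefficients are real and \<open>of_real\<close> is injective, so the
    identity descends from complex to real series.\<close>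
  then have "complex_of_real (fps_nth (Abs_fps (\<lambda>m. a m / fact m) * moment_egf M Y) n) =
      of_real (fps_nth (fps_exp t) n)" for n
    by (simp add: F_def G_def fps_mult_nth)
  then show ?thesis
    by (intro fps_ext) (simp only: of_real_eq_iff)
qed

text \<open>Each copy contributes one factor, the moment series of Y. Integrability is part of the
  induction because the product rule for the next summand relies on it.\<close>

lemma indep_copies_moment_egf_psum:
  assumes "prob_space N" and Y: "Y \<in> borel_measurable M"
    and int_Y: "\<And>n. integrable M (\<lambda>\<omega>. Y \<omega> ^ n)"
    and copies: "indep_copies M Y N X"
  shows "(\<forall>n. integrable N (\<lambda>\<omega>. (x + psum X k \<omega>) ^ n)) \<and>
    moment_egf N (\<lambda>\<omega>. x + psum X k \<omega>) = fps_exp x * moment_egf M Y ^ k"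
proof -
  interpret prob_space N by fact
  have indep: "indep_vars (\<lambda>_. borel) X {1..}"
    and distr: "\<And>j. j \<ge> 1 \<Longrightarrow> distr N borel (X j) = distr M borel Y"
    using copies by (auto simp: indep_copies_def)
  have X[measurable]: "X j \<in> borel_measurable N" if "j \<ge> 1" for j
    using indep that by (auto simp: indep_vars_def)
  have int_X: "integrable N (\<lambda>\<omega>. X j \<omega> ^ n)" if "j \<ge> 1" for j n
    using integrable_distr_eq[OF X[OF that], of "\<lambda>y. y ^ n"]
      integrable_distr_eq[OF Y, of "\<lambda>y. y ^ n"] int_Y distr[OF that]
    by simp
  have egf_X: "moment_egf N (X j) = moment_egf M Y" if "j \<ge> 1" for j
    using moment_egf_distr[OF X[OF that]] moment_egf_distr[OF Y] distr[OF that] by simp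
  show ?thesis
  proof (induction k)
    case 0
    then show ?case
      by (simp add: psum_def moment_egf_const)
  next
    case (Suc k)
    \<comment> \<open>Splitting off the index \<open>Suc k\<close> makes the new summand independent
      of the old partial sum; the shift by x preserves this.\<close>
    have "indep_vars (\<lambda>_. borel) X (insert (Suc k) {1..k})"
      by (rule indep_vars_subset[OF indep]) auto
    then have "indep_var borel (X (Suc k)) borel (psum X k)"
      unfolding psum_def by (intro indep_vars_sum) auto
    then have "indep_var borel (\<lambda>\<omega>. X (Suc k) \<omega>) borel (\<lambda>\<omega>. x + psum X k \<omega>)"
      using indep_var_compose[of borel _ borel _ "\<lambda>u. u" borel "\<lambda>v. x + v" borel]
      by (simp add: comp_def)
    from integrable_power_add_indep[OF this] moment_egf_add_indep[OF this] Suc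
    show ?case
      by (simp add: int_X egf_X psum_def algebra_simps)
  qed
qed

section \<open>Truncated geometric series in 1 - G\<close>

lemma sum_powers_one_minus:
  fixes G :: "'a :: comm_ring_1"
  shows "(\<Sum>r=0..n. (1 - G) ^ r) = (\<Sum>k=0..n. of_nat ((n + 1) choose (k + 1)) * (-1) ^ k * G ^ k)"
proof -
  have "(1 - G) ^ r = (\<Sum>k\<le>n. of_nat (r choose k) * (-1) ^ k * G ^ k)" if "r \<le> n" for r
  proof -
    have "(1 - G) ^ r = (\<Sum>k\<le>r. of_nat (r choose k) * (-1) ^ k * G ^ k)"
      using binomial_ring[of "- G" 1 r] by (simp add: power_minus[of G] mult.assoc)
    \<comment> \<open>Padding with zero binomial coefficients gives k a range independent of r, so
      the double sum can be swapped; summing over r is then the hockey-stick identity.\<close>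
    also have "\<dots> = (\<Sum>k\<le>n. of_nat (r choose k) * (-1) ^ k * G ^ k)"
      using that by (intro sum.mono_neutral_left) (auto simp: binomial_eq_0)
    finally show ?thesis .
  qed
  then have "(\<Sum>r\<le>n. (1 - G) ^ r) = (\<Sum>r\<le>n. \<Sum>k\<le>n. of_nat (r choose k) * (-1) ^ k * G ^ k)"
    by simp
  also have "\<dots> = (\<Sum>k\<le>n. of_nat (\<Sum>r\<le>n. r choose k) * (-1) ^ k * G ^ k)"
    by (subst sum.swap) (simp add: sum_distrib_right)
  also have "\<dots> = (\<Sum>k\<le>n. of_nat ((n + 1) choose (k + 1)) * (-1) ^ k * G ^ k)"
    by (simp only: sum_choose_upper) simp
  finally show ?thesis
    by (simp only: atLeast0AtMost)
qed

text \<open>Writing E as A(1 - (1 - G)) telescopes the geometric sum to A - A(1 - G)^(n+1). As 1 - G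
  has zero constant term, the remainder starts only in degree n + 1.\<close>

lemma fps_nth_eq_sum_powers_one_minus:
  fixes A G E :: "real fps"
  assumes "A * G = E" and "fps_nth G 0 = 1"
  shows "fps_nth A n = (\<Sum>r=0..n. fps_nth (E * (1 - G) ^ r) n)"
proof -
  have "E * (\<Sum>r\<le>n. (1 - G) ^ r) = A * (1 - (1 - G) ^ Suc n)"
    unfolding assms(1)[symmetric] using sum_gp_basic[of "1 - G" n] by (simp add: mult.assoc)
  then have "fps_nth (E * (\<Sum>r\<le>n. (1 - G) ^ r)) n = fps_nth A n - fps_nth (A * (1 - G) ^ Suc n) n"
    by (simp add: right_diff_distrib)
  moreover have "fps_nth ((1 - G) ^ Suc n) i = 0" if "i \<le> n" for i
    using assms(2) that startsby_zero_power_prefix[of "1 - G" "Suc n"] by auto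
  then have "fps_nth (A * (1 - G) ^ Suc n) n = 0"
    unfolding fps_mult_nth by (intro sum.neutral) (auto simp del: power_Suc)
  ultimately show ?thesis
    by (simp add: sum_distrib_left fps_sum_nth atLeast0AtMost)
qed

section \<open>Reading off the three formulas from the coefficients\<close>

theorem theorem1:
  fixes M :: "'a measure" and Y :: "'a \<Rightarrow> real"
    and N :: "'b measure" and X :: "nat \<Rightarrow> 'b \<Rightarrow> real"
    and A :: "nat \<Rightarrow> real poly"
    and n :: nat and x :: real
  assumes "prob_space M" and "Y \<in> borel_measurable M"
    and "\<exists>s>0. integrable M (\<lambda>\<omega>. exp (s * \<bar>Y \<omega>\<bar>))"
    and "prob_space N" and "indep_copies M Y N X"
    and "\<And>t :: real. \<forall>\<^sub>F z :: complex in nhds 0.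
           (\<lambda>m. of_real (poly (A m) t) * z ^ m / fact m) sums
             (exp (of_real t * z) / prob_space.expectation M (\<lambda>\<omega>. exp (z * of_real (Y \<omega>))))"
  shows "poly (A n) x = (\<Sum>r=0..n. (-1) ^ r * fact r * stirling2_poly N X n r x)
    \<and> poly (A n) x = (\<Sum>k=0..n. real ((n + 1) choose (k + 1)) * (-1) ^ k *
          prob_space.expectation N (\<lambda>\<omega>. (x + psum X k \<omega>) ^ n))
    \<and> poly (A n) x = (\<Sum>r=0..n. real (n choose r) * x ^ (n - r) *
          (\<Sum>k=0..r. real ((r + 1) choose (k + 1)) * (-1) ^ k *
             prob_space.expectation N (\<lambda>\<omega>. psum X k \<omega> ^ r)))"
proof -
  obtain s where s: "s > 0" "integrable M (\<lambda>\<omega>. exp (s * \<bar>Y \<omega>\<bar>))"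
    using assms(3) by blast
  define G where "G = moment_egf M Y"
  define a where "a t = Abs_fps (\<lambda>m. poly (A m) t / fact m)" for t
  have G0: "fps_nth G 0 = 1"
    using \<open>prob_space M\<close> by (simp add: G_def moment_egf_nth prob_space.prob_space)
  have aG: "a t * G = fps_exp t" for t
    unfolding a_def G_def
    by (rule fps_mult_moment_egf_eq_fps_exp[OF assms(1,2) s assms(6)])
  have moments: "prob_space.expectation N (\<lambda>\<omega>. (t + psum X k \<omega>) ^ m) =
      fact m * fps_nth (fps_exp t * G ^ k) m" for t k m
  proof -
    have "moment_egf N (\<lambda>\<omega>. t + psum X k \<omega>) = fps_exp t * G ^ k"
      using indep_copies_moment_egf_psum[OF assms(4,2) _ assms(5)]
        integrable_power_of_exp_moment[OF assms(2) s]
      by (simp add: G_def)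
    then show ?thesis
      using moment_egf_nth[of N "\<lambda>\<omega>. t + psum X k \<omega>" m] by simp
  qed
  have coeff: "poly (A m) t = fact m * (\<Sum>r=0..m. fps_nth (fps_exp t * (1 - G) ^ r) m)" for m t
    using fps_nth_eq_sum_powers_one_minus[OF aG G0, of t m] by (simp add: a_def field_simps)
  \<comment> \<open>In the expansions of powers of 1 - G the binomial coefficients and signs are
    themselves power series; here they become real factors in front of a coefficient.\<close>
  have scale: "fps_nth (E * (of_nat c * (-1) ^ k * H)) m = real c * (-1) ^ k * fps_nth (E * H) m"
    for c k m and E H :: "real fps"
  proof -
    have "of_nat c * (-1) ^ k = fps_const (real c * (-1) ^ k)"
      by (simp add: fps_of_nat flip: fps_const_mult fps_const_power fps_const_neg)
    then have "E * (of_nat c * (-1) ^ k * H) = fps_const (real c * (-1) ^ k) * (E * H)"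
      by (simp only: mult.left_commute)
    then show ?thesis
      by (simp only: fps_mult_left_const_nth)
  qed
  have binom: "poly (A m) t = (\<Sum>k=0..m. real ((m + 1) choose (k + 1)) * (-1) ^ k *
      prob_space.expectation N (\<lambda>\<omega>. (t + psum X k \<omega>) ^ m))" for m t
  proof -
    have "poly (A m) t = fact m * fps_nth (fps_exp t * (\<Sum>r=0..m. (1 - G) ^ r)) m"
      by (simp add: coeff sum_distrib_left fps_sum_nth)
    also have "\<dots> = (\<Sum>k=0..m. real ((m + 1) choose (k + 1)) * (-1) ^ k *
        (fact m * fps_nth (fps_exp t * G ^ k) m))"
      unfolding sum_powers_one_minus sum_distrib_left fps_sum_nth scale
      by (simp add: mult_ac)
    finally show ?thesis
      by (simp only: moments)
  qed
  have stirling: "(-1) ^ r * fact r * stirling2_poly N X n r x =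
      fact n * fps_nth (fps_exp x * (1 - G) ^ r) n" for r
  proof -
    \<comment> \<open>For k \<le> r the total exponent 2r - k has the parity of k, which turns
      powers of G - 1 into powers of 1 - G.\<close>
    have sgn: "(-1) ^ r * (-1) ^ (r - k) = ((-1) ^ k :: real)" if "k \<le> r" for k
      using that by (simp add: minus_one_power_iff)
    have "(-1) ^ r * fact r * stirling2_poly N X n r x =
        (\<Sum>k=0..r. ((-1) ^ r * (-1) ^ (r - k)) * (real (r choose k) *
          (fact n * fps_nth (fps_exp x * G ^ k) n)))"
      by (simp add: stirling2_poly_def moments sum_distrib_left mult_ac)
    also have "\<dots> = (\<Sum>k=0..r. fact n * (real (r choose k) * (-1) ^ k *
        fps_nth (fps_exp x * G ^ k) n))"
      by (intro sum.cong) (simp_all add: sgn mult_ac)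
    also have "\<dots> = fact n * fps_nth (fps_exp x *
        (\<Sum>k=0..r. of_nat (r choose k) * (-1) ^ k * G ^ k)) n"
      by (simp only: sum_distrib_left fps_sum_nth scale)
    also have "(\<Sum>k=0..r. of_nat (r choose k) * (-1) ^ k * G ^ k) = (1 - G) ^ r"
      using binomial_ring[of "- G" 1 r]
      by (simp add: power_minus[of G] mult.assoc atLeast0AtMost)
    finally show ?thesis .
  qed
  \<comment> \<open>Both sides equal \<open>fps_exp x\<close>, since \<open>a 0 * G\<close> is 1.
    Cancelling the nonzero G yields the Appell property of the sequence.\<close>
  have "a x * G = (fps_exp x * a 0) * G"
    using aG[of x] aG[of 0] by (simp add: mult.assoc)
  then have ax: "a x = a 0 * fps_exp x"
    using G0 by (auto simp: mult.commute)
  have "poly (A n) x = fact n * fps_nth (a x) n"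
    by (simp add: a_def)
  also have "\<dots> = fact n * fps_nth (a 0 * fps_exp x) n"
    by (simp only: ax)
  also have "\<dots> = (\<Sum>r=0..n. real (n choose r) * x ^ (n - r) * poly (A r) 0)"
    unfolding fps_mult_nth sum_distrib_left
    by (intro sum.cong) (simp_all add: a_def binomial_fact)
  finally have "poly (A n) x = (\<Sum>r=0..n. real (n choose r) * x ^ (n - r) * poly (A r) 0)" .
  \<comment> \<open>The first formula is \<open>coeff\<close> rewritten by \<open>stirling\<close>,
    the second is \<open>binom\<close> at x, and the third inserts \<open>binom\<close> at 0, where
    0 + S_k is S_k.\<close>
  then show ?thesis
    using binom[of n x] binom[of _ 0] coeff[of n x]
    by (simp only: stirling sum_distrib_left add_0_left)
qed

end
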